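(* Let $F:\mathbb{R}^m\to\mathbb{R}^n$ be of class $C^2$ and let $f(\theta)=\tfrac12\|F(\theta)\|_2^2$. Assume: (i) there is $\theta^*\in\mathbb{R}^m$ with $F(\theta^* )=0$; (ii) there are an open neighborhood $U$ of $\theta^*$ and an integer $r\ge 1$ such that $\operatorname{rank} J_F(\theta)=r$ for all $\theta\in U$; (iii) there is $L>0$ with $\|\nabla f(\theta_1)-\nabla f(\theta_2)\|_2\le L\|\theta_1-\theta_2\|_2$ for all $\theta_1,\theta_2\in U$. Let $W\subset U$ be an adapted neighborhood of $\theta^*$ with projection map $\pi:W\to\mathcal{M}$ (see context), and let $\sigma_{\min},\sigma_{\max}>0$ be constants such that for every $\theta\in W$ all nonzero singular values of $J_F(\theta)$ lie in $[\sigma_{\min},\sigma_{\max}]$. Then for every step size $\alpha$ with $0<\alpha\le 1/\sigma_{\max}$ there exists a neighborhood $U_\alpha\subset W$ of $\theta^*$ such that, for every $\theta_0\in U_\alpha$, the sequence defined by $$\theta_{t+1}=\theta_t-\alpha V_tU_t^\top F(\theta_t),\qquad t\ge 0,$$ where $J_F(\theta_t)=U_t\Sigma_tV_t^\top$ is the compact singular value decomposition, satisfies $$f(\theta_t)\le\Big(1-\frac{\alpha\sigma_{\min}}{2}\Big)^t f(\theta_0)\qquad\text{for all } t\ge 0 .$$ In particular, $f(\theta_t)$ converges to $0$ at a linear rate.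
   Context: $J_F(\theta)\in\mathbb{R}^{n\times m}$ is the Jacobian matrix of $F$ at $\theta$. The compact (economy-sized) SVD of a rank-$r$ matrix $J\in\mathbb{R}^{n\times m}$ is $J=U\Sigma V^\top$ with $U\in\mathbb{R}^{n\times r}$ and $V\in\mathbb{R}^{m\times r}$ having orthonormal columns and $\Sigma\in\mathbb{R}^{r\times r}$ diagonal with the $r$ nonzero singular values (so the columns of $U$ are an orthonormal basis of the range of $J$; the matrix $VU^\top$ does not depend on the choice of SVD). By the constant-rank level set theorem, $\mathcal{M}=\{\theta\in U:F(\theta)=0\}$ is an embedded submanifold of $\mathbb{R}^m$ of codimension $r$; $N_p\mathcal{M}$ denotes its normal space at $p$. Tubular neighborhood: an open set $V\subset U$ containing $\theta^*$ of the form $V=\{p+v: p\in S,\ v\in N_p\mathcal{M},\ \|v\|_2<\rho\}$, with $S$ an open neighborhood of $\theta^*$ in $\mathcal{M}$ and $\rho>0$, such that each $\theta\in V$ has a unique representation $\theta=p+v$ of this form and the projection map $\pi:V\to\mathcal{M}$, $\pi(p+v)=p$, is continuous. Adapted neighborhood of $\theta^*$: an open neighborhood $W$ of $\theta^*$ contained in such a tubular neighborhood $V$ (with $\pi$ restricted to $W$) such that, with $n(\theta)=\theta-\pi(\theta)$, for all $\theta\in W$ one has $\|F(\theta)\|_2\ge\tfrac12 s\,\|n(\theta)\|_2$, where $s$ is the smallest nonzero singular value of $J_F(\theta^* )$, and there is a constant $C_\perp>0$ with $\|P_{\mathcal{R}(\theta)^\perp}F(\theta)\|_2\le C_\perp\|F(\theta)\|_2^2$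 for all $\theta\in W$, where $P_{\mathcal{R}(\theta)^\perp}$ is the orthogonal projection onto the orthogonal complement of $\mathcal{R}(\theta)=\operatorname{range}J_F(\theta)$. *)

theory Defs
  imports "HOL-Analysis.Analysis"
begin

definition C2_map :: "('a::real_normed_vector \<Rightarrow> 'b::real_normed_vector) \<Rightarrow> bool" where
  "C2_map F \<longleftrightarrow>
     (\<exists>(F' :: 'a \<Rightarrow> 'a \<Rightarrow>\<^sub>L 'b) (F'' :: 'a \<Rightarrow> 'a \<Rightarrow>\<^sub>L ('a \<Rightarrow>\<^sub>L 'b)).
        (\<forall>x. (F has_derivative blinfun_apply (F' x)) (at x)) \<and>
        (\<forall>x. (F' has_derivative blinfun_apply (F'' x)) (at x)) \<and>
        continuous_on UNIV F'')"

definition grad :: "('a::real_inner \<Rightarrow> real) \<Rightarrow> 'a \<Rightarrow> 'a" where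
  "grad f x = (THE D. GDERIV f x :> D)"

text \<open>The singular values of a matrix are the square roots of the eigenvalues of its Gram matrix;
  only the nonzero ones are collected here (as a set, without multiplicity).\<close>

definition nonzero_singular_values :: "real^'m^'n \<Rightarrow> real set" where
  "nonzero_singular_values A =
     {\<sigma>. \<sigma> > 0 \<and> (\<exists>v. v \<noteq> 0 \<and> (transpose A ** A) *v v = \<sigma>\<^sup>2 *\<^sub>R v)}"

text \<open>Compact singular value decomposition: the rank is the cardinality of the index type
  \<open>'r\<close>.  The multiplicities of the diagonal entries are forced by the factorization.\<close>

definition compact_svd ::
    "real^'m^'n \<Rightarrow> real^'r^'n \<Rightarrow> real^'r^'r \<Rightarrow> real^'r^'m \<Rightarrow> bool" where
  "compact_svd J U \<Sigma> V \<longleftrightarrow>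
     rank J = CARD('r) \<and>
     transpose U ** U = mat 1 \<and>
     transpose V ** V = mat 1 \<and>
     (\<forall>i j. i \<noteq> j \<longrightarrow> \<Sigma> $ i $ j = 0) \<and>
     range (\<lambda>i. \<Sigma> $ i $ i) = nonzero_singular_values J \<and>
     J = U ** \<Sigma> ** transpose V"

definition svd_iteration ::
    "(real^'m \<Rightarrow> real^'n) \<Rightarrow> real \<Rightarrow> (nat \<Rightarrow> real^'m) \<Rightarrow>
     (nat \<Rightarrow> real^'r^'n) \<Rightarrow> (nat \<Rightarrow> real^'r^'r) \<Rightarrow> (nat \<Rightarrow> real^'r^'m) \<Rightarrow> bool" where
  "svd_iteration F \<alpha> \<theta> U \<Sigma> V \<longleftrightarrow>
     (\<forall>t. compact_svd (jacobian F (at (\<theta> t))) (U t) (\<Sigma> t) (V t) \<and>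
          \<theta> (Suc t) = \<theta> t - \<alpha> *\<^sub>R ((V t ** transpose (U t)) *v F (\<theta> t)))"

definition zero_set_on :: "'a set \<Rightarrow> ('a \<Rightarrow> 'b::zero) \<Rightarrow> 'a set" where
  "zero_set_on U F = {\<theta> \<in> U. F \<theta> = 0}"

text \<open>Tangent vectors of an embedded submanifold are the velocities of \<open>C\<^sup>1\<close> curves
  lying in it.\<close>

definition tangent_space :: "'a::real_normed_vector set \<Rightarrow> 'a \<Rightarrow> 'a set" where
  "tangent_space M p =
     {w. \<exists>\<gamma> \<epsilon>. \<epsilon> > 0 \<and> \<gamma> C1_differentiable_on {-\<epsilon><..<\<epsilon>} \<and> \<gamma> ` {-\<epsilon><..<\<epsilon>} \<subseteq> M \<and>
         \<gamma> 0 = p \<and> (\<gamma> has_vector_derivative w) (at 0)}"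

definition normal_space :: "'a::euclidean_space set \<Rightarrow> 'a \<Rightarrow> 'a set" where
  "normal_space M p = (tangent_space M p)\<^sup>\<bottom>"

definition tubular_neighborhood ::
    "'a::euclidean_space set \<Rightarrow> 'a set \<Rightarrow> 'a \<Rightarrow> 'a set \<Rightarrow> ('a \<Rightarrow> 'a) \<Rightarrow> bool" where
  "tubular_neighborhood U M \<theta>s V \<pi> \<longleftrightarrow>
     open V \<and> V \<subseteq> U \<and> \<theta>s \<in> V \<and>
     (\<exists>S \<rho>. \<theta>s \<in> S \<and> openin (top_of_set M) S \<and> \<rho> > 0 \<and>
        (let E = {(p, v). p \<in> S \<and> v \<in> normal_space M p \<and> norm v < \<rho>} in
           V = (\<lambda>(p, v). p + v) ` E \<and>
           inj_on (\<lambda>(p, v). p + v) E \<and>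
           (\<forall>(p, v)\<in>E. \<pi> (p + v) = p))) \<and>
     continuous_on V \<pi>"

definition orth_proj :: "'a::euclidean_space set \<Rightarrow> 'a \<Rightarrow> 'a" where
  "orth_proj S x = (THE y. y \<in> S \<and> x - y \<in> S\<^sup>\<bottom>)"

definition jac_range :: "(real^'m \<Rightarrow> real^'n) \<Rightarrow> real^'m \<Rightarrow> (real^'n) set" where
  "jac_range F \<theta> = range (\<lambda>h. jacobian F (at \<theta>) *v h)"

definition adapted_neighborhood ::
    "(real^'m \<Rightarrow> real^'n) \<Rightarrow> (real^'m) set \<Rightarrow> real^'m \<Rightarrow> (real^'m) set \<Rightarrow>
     (real^'m \<Rightarrow> real^'m) \<Rightarrow> bool" where
  "adapted_neighborhood F U \<theta>s W \<pi> \<longleftrightarrow>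
     open W \<and> \<theta>s \<in> W \<and>
     (\<exists>V. W \<subseteq> V \<and> tubular_neighborhood U (zero_set_on U F) \<theta>s V \<pi>) \<and>
     (\<forall>\<theta>\<in>W. norm (F \<theta>) \<ge>
        1/2 * Min (nonzero_singular_values (jacobian F (at \<theta>s))) * norm (\<theta> - \<pi> \<theta>)) \<and>
     (\<exists>C>0. \<forall>\<theta>\<in>W. norm (orth_proj ((jac_range F \<theta>)\<^sup>\<bottom>) (F \<theta>)) \<le> C * (norm (F \<theta>))\<^sup>2)"

definition converges_linearly :: "(nat \<Rightarrow> 'a::metric_space) \<Rightarrow> 'a \<Rightarrow> bool" where
  "converges_linearly x l \<longleftrightarrow> (\<exists>C q. 0 < q \<and> q < 1 \<and> (\<forall>t. dist (x t) l \<le> C * q ^ t))"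

end

theory Submission
  imports Defs
begin

text \<open>In one step \<open>J d = U \<Sigma> U\<^sup>T F\<close> for \<open>d = V U\<^sup>T F\<close>, so the part of \<open>F\<close> in the range of \<open>J\<close>
  shrinks by a factor \<open>1 - \<alpha> \<sigma>min\<close>, while its orthogonal part (by adaptedness) and the Taylor remainder are
  \<open>O(|F|\<^sup>2)\<close>. Near the zero the residual norm therefore contracts by \<open>1 - \<alpha> \<sigma>min / 2\<close>, and since
  \<open>|d| \<le> |F|\<close> the steps are summable and the iterates stay close to the zero.\<close>

text \<open>As a simp rule it would turn \<open>transpose A *v x\<close> into \<open>x v* A\<close>;
  the adjoint computations below keep the first form.\<close>

declare transpose_matrix_vector [simp del]

section \<open>Spectral theorem on an invariant subspace\<close>

text \<open>By compactness the form \<open>x \<bullet> A x\<close> attains a maximum on the unit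
  sphere of \<open>S\<close>, and a maximizer is an eigenvector: the residual of the eigenvalue
  equation would otherwise be a direction of increase.\<close>

lemma self_adjoint_eigenvector:
  fixes A :: "'a::euclidean_space \<Rightarrow> 'a"
  assumes "linear A" and adj: "\<And>x y. A x \<bullet> y = x \<bullet> A y"
    and S: "subspace S" "S \<noteq> {0}" and inv: "\<And>x. x \<in> S \<Longrightarrow> A x \<in> S"
  obtains v where "v \<in> S" "norm v = 1" "A v = (v \<bullet> A v) *\<^sub>R v"
proof -
  interpret A: linear A by fact
  let ?K = "S \<inter> sphere 0 1"
  have "compact ?K"
    using S(1) by (simp add: closed_Int_compact closed_subspace)
  moreover have "?K \<noteq> {}"
  proof -
    obtain w where "w \<in> S" "w \<noteq> 0"
      using S subspace_0 by blast
    then have "w /\<^sub>R norm w \<in> ?K"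
      using S(1) by (simp add: subspace_scale)
    then show ?thesis by blast
  qed
  moreover have "continuous_on ?K (\<lambda>x. x \<bullet> A x)"
    by (intro continuous_intros linear_continuous_on linear_conv_bounded_linear[THEN iffD1] \<open>linear A\<close>)
  ultimately obtain v where v: "v \<in> ?K" and max: "\<And>x. x \<in> ?K \<Longrightarrow> x \<bullet> A x \<le> v \<bullet> A v"
    using continuous_attains_sup by metis
  define l where "l = v \<bullet> A v"
  have vS: "v \<in> S" and nv: "norm v = 1" and vv: "v \<bullet> v = 1"
    using v by (auto simp: norm_eq_1)
  \<comment> \<open>Homogeneity carries the maximum from the unit sphere over to all of
    \<open>S\<close>.\<close>
  have Q: "x \<bullet> A x \<le> l * (x \<bullet> x)" if "x \<in> S" for x
  proof (cases "x = 0")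
    case False
    then have "x /\<^sub>R norm x \<in> ?K"
      using that S(1) by (simp add: subspace_scale)
    from max[OF this] have "(x \<bullet> A x) / (norm x)\<^sup>2 \<le> l"
      using False by (simp add: A.scaleR l_def power2_eq_square divide_inverse mult_ac)
    then show ?thesis
      using False by (simp add: power2_norm_eq_inner divide_le_eq)
  qed (simp add: A.zero)
  \<comment> \<open>The residual of the eigenvalue equation. It lies in \<open>S\<close> by
    invariance, so \<open>v + t w\<close> may be compared with the maximizer.\<close>
  define w where "w = A v - l *\<^sub>R v"
  have wS: "w \<in> S"
    using S(1) vS inv by (simp add: w_def subspace_diff subspace_scale)
  have "w \<bullet> w = 0"
  proof (rule ccontr)
    \<comment> \<open>The form \<open>l |x|\<^sup>2 - x \<bullet> A x\<close> is nonnegative on \<open>S\<close> and vanishes at \<open>v\<close>;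
      its value at \<open>v + t w\<close> is \<open>t\<^sup>2 c - 2 t |w|\<^sup>2\<close>, which is negative for small \<open>t > 0\<close>.\<close>
    assume "w \<bullet> w \<noteq> 0"
    then have pos: "w \<bullet> w > 0" by (metis inner_gt_zero_iff inner_zero_left)
    define c where "c = l * (w \<bullet> w) - w \<bullet> A w"
    have c0: "c \<ge> 0" using Q[OF wS] by (simp add: c_def)
    have ineq: "2 * t * (w \<bullet> w) \<le> t\<^sup>2 * c" for t
    proof -
      have "v + t *\<^sub>R w \<in> S" using vS wS S(1) by (simp add: subspace_add subspace_scale)
      from Q[OF this] have "v \<bullet> A v + 2 * t * (w \<bullet> A v) + t\<^sup>2 * (w \<bullet> A w)
          \<le> l * (1 + 2 * t * (w \<bullet> v) + t\<^sup>2 * (w \<bullet> w))"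
        using adj[of v w]
        by (simp add: A.add A.scaleR inner_add_left inner_add_right vv power2_eq_square algebra_simps inner_commute)
      moreover have "w \<bullet> A v = w \<bullet> w + l * (w \<bullet> v)"
        by (simp add: w_def inner_diff_right inner_diff_left)
      ultimately show ?thesis
        by (simp add: c_def l_def algebra_simps)
    qed
    \<comment> \<open>The denominator \<open>c + 1\<close> is positive even when
      \<open>c = 0\<close>, and it keeps \<open>t c\<close> at most \<open>w \<bullet> w\<close>,
      while \<open>ineq\<close> demands at least twice that.\<close>
    define t where "t = (w \<bullet> w) / (c + 1)"
    have t: "t > 0" using pos c0 by (simp add: t_def)
    have "t * c \<le> w \<bullet> w" using pos c0 by (simp add: t_def divide_simps)
    moreover have "2 * (w \<bullet> w) \<le> t * c"
      using ineq[of t] t by (simp add: power2_eq_square)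
    ultimately show False using pos by linarith
  qed
  then have "A v = l *\<^sub>R v" by (simp add: w_def)
  with that vS nv show ?thesis by (simp add: l_def)
qed

text \<open>Induction on the dimension: one unit eigenvector \<open>v\<close> is split off, and
  self-adjointness makes the orthogonal complement of \<open>v\<close> in \<open>S\<close> invariant
  again. Admitting any invariant \<open>S\<close> serves this induction and also the later
  restriction to the range of a transpose.\<close>

lemma self_adjoint_orthonormal_eigenbasis:
  fixes A :: "'a::euclidean_space \<Rightarrow> 'a"
  assumes "linear A" and adj: "\<And>x y. A x \<bullet> y = x \<bullet> A y"
    and "subspace S" and "\<And>x. x \<in> S \<Longrightarrow> A x \<in> S"
  shows "\<exists>B. pairwise orthogonal B \<and> (\<forall>b\<in>B. norm b = 1 \<and> A b = (b \<bullet> A b) *\<^sub>R b) \<and> span B = S"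
  using assms(3,4)
proof (induction "dim S" arbitrary: S rule: less_induct)
  case less
  show ?case
  proof (cases "S = {0}")
    case True
    then show ?thesis by (intro exI[of _ "{}"]) auto
  next
    case False
    then obtain v where v: "v \<in> S" "norm v = 1" "A v = (v \<bullet> A v) *\<^sub>R v"
      using self_adjoint_eigenvector[OF assms(1) adj less.prems(1) _ less.prems(2)] by blast
    let ?T = "S \<inter> {x. orthogonal v x}"
    have T: "subspace ?T"
      using less.prems(1) subspace_orthogonal_to_vector by (rule subspace_inter)
    have "v \<notin> ?T" using v(2) by (auto simp: orthogonal_self)
    then have "?T \<subset> S" using v(1) by blast
    then have "dim ?T < dim S"
      using T less.prems(1) by (metis dim_psubset span_eq_iff)
    moreover have "A x \<in> ?T" if "x \<in> ?T" for x
    proof -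
      have "v \<bullet> A x = (v \<bullet> A v) * (v \<bullet> x)"
        by (metis adj inner_scaleR_left v(3))
      then show ?thesis using that less.prems(2) by (simp add: orthogonal_def)
    qed
    ultimately obtain B where B: "pairwise orthogonal B"
      "\<forall>b\<in>B. norm b = 1 \<and> A b = (b \<bullet> A b) *\<^sub>R b" "span B = ?T"
      using less.hyps[OF _ T] by blast
    have "\<forall>b\<in>B. orthogonal v b" using B(3) span_base by blast
    then have "pairwise orthogonal (insert v B)"
      using B(1) by (auto simp: pairwise_insert orthogonal_commute)
    moreover have "span (insert v B) = S"
    proof
      show "span (insert v B) \<subseteq> S"
        using B(3) v(1) less.prems(1) by (intro span_minimal) (auto intro: span_base)
    next
      show "S \<subseteq> span (insert v B)"
      proof
        fix x assume "x \<in> S"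
        then have "x - (v \<bullet> x) *\<^sub>R v \<in> ?T"
          using v(1,2) less.prems(1)
          by (simp add: subspace_diff subspace_scale orthogonal_def inner_diff_right norm_eq_1)
        then show "x \<in> span (insert v B)"
          unfolding B(3)[symmetric] by (auto simp: span_insert)
      qed
    qed
    ultimately show ?thesis using B(2) v by blast
  qed
qed

section \<open>Existence of a compact singular value decomposition\<close>

lemma matrix_vector_inner_transpose:
  fixes A :: "real^'m^'n"
  shows "(A *v x) \<bullet> y = x \<bullet> (transpose A *v y)"
  by (metis dot_lmul_matrix inner_commute vector_transpose_matrix transpose_transpose)

lemma columns_mult_vector:
  fixes u :: "'r::finite \<Rightarrow> real^'n"
  shows "(\<chi> i j. u j $ i) *v z = (\<Sum>j\<in>UNIV. z $ j *\<^sub>R u j)"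
  by (simp add: vec_eq_iff matrix_vector_mult_def mult.commute)

lemma transpose_columns_mult_vector:
  fixes u :: "'r::finite \<Rightarrow> real^'n"
  shows "transpose (\<chi> i j. u j $ i) *v y = (\<chi> j. u j \<bullet> y)"
  by (simp add: vec_eq_iff matrix_vector_mult_def transpose_def inner_vec_def)

lemma transpose_columns_mult_columns:
  fixes u :: "'r::finite \<Rightarrow> real^'n"
  assumes "\<And>i j. u i \<bullet> u j = (if i = j then 1 else 0)"
  shows "transpose (\<chi> i j. u j $ i) ** (\<chi> i j. u j $ i) = (mat 1 :: real^'r^'r)"
  using assms
  by (simp add: vec_eq_iff matrix_matrix_mult_def transpose_def mat_def inner_vec_def)

text \<open>The right singular vectors \<open>g j\<close> are an orthonormal eigenbasis of
  \<open>J\<^sup>T J\<close> on the range of \<open>J\<^sup>T\<close>, a space of dimension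
  \<open>rank J\<close>; the left ones are the normalized images \<open>J g j\<close>. Leaving out
  the kernel of \<open>J\<close> is what makes every diagonal entry positive.\<close>

lemma ex_compact_svd:
  fixes J :: "real^'m^'n"
  assumes rank: "rank J = CARD('r::finite)"
  shows "\<exists>(U :: real^'r^'n) \<Sigma> V. compact_svd J U \<Sigma> V"
proof -
  let ?A = "\<lambda>x. transpose J *v (J *v x)"
  let ?S = "range (\<lambda>y. transpose J *v y)"
  have S: "subspace ?S"
    by (intro linear_subspace_image matrix_vector_mul_linear subspace_UNIV)
  have adj: "?A x \<bullet> y = x \<bullet> ?A y" for x y
    by (metis inner_commute matrix_vector_inner_transpose)
  have "linear ?A"
    using linear_compose[OF matrix_vector_mul_linear[of J] matrix_vector_mul_linear[of "transpose J"]] by (simp add: o_def)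
  then obtain B where orth: "pairwise orthogonal B"
    and B: "\<And>b. b \<in> B \<Longrightarrow> norm b = 1" "\<And>b. b \<in> B \<Longrightarrow> ?A b = (b \<bullet> ?A b) *\<^sub>R b"
    and span: "span B = ?S"
    using self_adjoint_orthonormal_eigenbasis[OF _ adj S] by blast
  have "0 \<notin> B" using B(1) by fastforce
  then have indep: "independent B" using orth pairwise_orthogonal_independent by blast
  then have fin: "finite B" by (rule independent_imp_finite)
  have "card B = dim ?S"
    using indep span by (metis dim_span_eq_card_independent)
  also have "\<dots> = CARD('r)"
    using rank by (metis rank_dim_range rank_transpose)
  finally obtain g :: "'r \<Rightarrow> real^'m" where g: "bij_betw g UNIV B"
    using fin by (metis bij_betw_iff_card finite)
  have gB: "g i \<in> B" for i using g by (auto simp: bij_betw_def)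
  have gg: "g i \<bullet> g j = (if i = j then 1 else 0)" for i j
  proof (cases "i = j")
    case True then show ?thesis using B(1)[OF gB] by (simp add: norm_eq_1)
  next
    case False
    then have "g i \<noteq> g j" using g by (auto simp: bij_betw_def inj_on_def)
    then show ?thesis using orth gB False by (auto simp: pairwise_def orthogonal_def)
  qed
  \<comment> \<open>The remainder \<open>k\<close> is orthogonal to the range of
    \<open>J\<^sup>T\<close>, hence to \<open>J\<^sup>T J k\<close>, which says that
    \<open>|J k|\<^sup>2 = 0\<close>.\<close>
  have expand: "J *v h = J *v (\<Sum>j\<in>UNIV. (g j \<bullet> h) *\<^sub>R g j)" for h
  proof -
    define k where "k = h - (\<Sum>j\<in>UNIV. (g j \<bullet> h) *\<^sub>R g j)"
    have "g i \<bullet> k = 0" for i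
      by (simp add: k_def inner_diff_right inner_sum_right gg if_distrib[of "(*) _"] cong: if_cong)
    then have "orthogonal k y" if "y \<in> B" for y
      using that g by (auto simp: bij_betw_def orthogonal_def inner_commute)
    then have "orthogonal k x" if "x \<in> ?S" for x
      using that span orthogonal_to_span by blast
    then have "k \<bullet> (transpose J *v (J *v k)) = 0" by (simp add: orthogonal_def)
    then have "J *v k = 0"
      by (simp flip: matrix_vector_inner_transpose)
    then show ?thesis by (simp add: k_def matrix_vector_mult_diff_distrib)
  qed
  \<comment> \<open>On the range of \<open>J\<^sup>T\<close> the map \<open>J\<close> is injective,
    so none of the numbers \<open>\<sigma> j\<close> vanishes.\<close>
  have AS: "J *v x \<noteq> 0" if "x \<in> ?S" "x \<noteq> 0" for x
  proof
    assume 0: "J *v x = 0"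
    obtain y where y: "x = transpose J *v y" using \<open>x \<in> ?S\<close> by blast
    have "x \<bullet> x = (J *v x) \<bullet> y" by (simp add: matrix_vector_inner_transpose flip: y)
    with 0 \<open>x \<noteq> 0\<close> show False by simp
  qed
  define \<sigma> where "\<sigma> j = norm (J *v g j)" for j
  have \<sigma>: "\<sigma> j > 0" for j
    using AS[of "g j"] gB[of j] span span_base[of "g j" B] \<open>0 \<notin> B\<close> unfolding \<sigma>_def by fastforce
  then have \<sigma>0: "\<sigma> j \<noteq> 0" for j by (metis less_irrefl)
  have Ag: "?A (g j) = (\<sigma> j)\<^sup>2 *\<^sub>R g j" for j
    using B(2)[OF gB, of j] unfolding \<sigma>_def
    by (simp add: power2_norm_eq_inner matrix_vector_inner_transpose)
  \<comment> \<open>Orthogonality of the \<open>g j\<close> passes to their images because they are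
    eigenvectors of \<open>J\<^sup>T J\<close>; this gives orthonormal columns of \<open>U\<close>
    after scaling.\<close>
  have JJ: "(J *v g i) \<bullet> (J *v g j) = (if i = j then (\<sigma> i)\<^sup>2 else 0)" for i j
    by (simp add: matrix_vector_inner_transpose Ag gg)
  define U :: "real^'r^'n" where "U = (\<chi> i j. ((1 / \<sigma> j) *\<^sub>R (J *v g j)) $ i)"
  define V :: "real^'r^'m" where "V = (\<chi> i j. g j $ i)"
  define \<Sigma> :: "real^'r^'r" where "\<Sigma> = (\<chi> i j. if i = j then \<sigma> i else 0)"
  have "transpose U ** U = mat 1"
    unfolding U_def
    by (intro transpose_columns_mult_columns) (simp add: JJ power2_eq_square \<sigma>0)
  moreover have "transpose V ** V = mat 1"
    unfolding V_def by (intro transpose_columns_mult_columns gg)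
  moreover have "J = U ** \<Sigma> ** transpose V"
  proof -
    have "J *v h = (U ** \<Sigma> ** transpose V) *v h" for h
    proof -
      have "\<Sigma> *v z = (\<chi> j. \<sigma> j * z $ j)" for z
        by (simp add: \<Sigma>_def vec_eq_iff matrix_vector_mult_def if_distrib[of "\<lambda>x. x * _"] cong: if_cong)
      then have "(U ** \<Sigma> ** transpose V) *v h = (\<Sum>j\<in>UNIV. (g j \<bullet> h) *\<^sub>R (J *v g j))"
        unfolding U_def V_def matrix_vector_mul_assoc[symmetric]
          columns_mult_vector transpose_columns_mult_vector
        by (simp add: \<sigma>0)
      also have "\<dots> = J *v h"
        by (subst (2) expand) (simp add: linear_sum[of "(*v) J"] linear_cmul[of "(*v) J"] )
      finally show ?thesis ..
    qed
    then show ?thesis by (simp add: matrix_eq)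
  qed
  moreover have "range (\<lambda>i. \<Sigma> $ i $ i) = nonzero_singular_values J"
  proof
    have "g i \<noteq> 0" for i using gB \<open>0 \<notin> B\<close> by metis
    then have "\<sigma> i \<in> nonzero_singular_values J" for i
      unfolding nonzero_singular_values_def using \<sigma> Ag
      by (metis (mono_tags, lifting) matrix_vector_mul_assoc mem_Collect_eq)
    then show "range (\<lambda>i. \<Sigma> $ i $ i) \<subseteq> nonzero_singular_values J"
      by (auto simp: \<Sigma>_def)
  next
    show "nonzero_singular_values J \<subseteq> range (\<lambda>i. \<Sigma> $ i $ i)"
    proof
      fix s assume "s \<in> nonzero_singular_values J"
      then obtain v where s: "s > 0" and v: "v \<noteq> 0" "?A v = s\<^sup>2 *\<^sub>R v"
        unfolding nonzero_singular_values_def by (auto simp flip: matrix_vector_mul_assoc)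
      \<comment> \<open>No singular value is missed: an eigenvector orthogonal to all
        \<open>g j\<close> would be killed by \<open>J\<close>, and an eigenvector that is not
        orthogonal to \<open>g j\<close> shares its eigenvalue by self-adjointness.\<close>
      have "\<exists>j. g j \<bullet> v \<noteq> 0"
      proof (rule ccontr)
        assume "\<not> ?thesis"
        then have "J *v v = 0" using expand[of v] by simp
        then show False using v s by simp
      qed
      then obtain j where j: "g j \<bullet> v \<noteq> 0" ..
      have "(\<sigma> j)\<^sup>2 * (g j \<bullet> v) = s\<^sup>2 * (g j \<bullet> v)"
        using adj[of "g j" v] unfolding Ag v(2) by simp
      then have "s = \<sigma> j" using j s \<sigma>[of j] by (simp add: power2_eq_iff_nonneg)
      then show "s \<in> range (\<lambda>i. \<Sigma> $ i $ i)" by (auto simp: \<Sigma>_def)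
    qed
  qed
  ultimately have "compact_svd J U \<Sigma> V"
    unfolding compact_svd_def using rank by (simp add: \<Sigma>_def)
  then show ?thesis by blast
qed

section \<open>The factors as isometries, and the projection onto the range\<close>

lemma compact_svd_mult_vector:
  assumes "compact_svd J U \<Sigma> V"
  shows "J *v h = U *v (\<Sigma> *v (transpose V *v h))"
  using assms unfolding compact_svd_def by (metis matrix_vector_mul_assoc)

lemma compact_svd_transpose_mult:
  assumes "compact_svd J U \<Sigma> V"
  shows "transpose U *v (U *v z) = z" "transpose V *v (V *v z) = z"
  using assms by (simp_all add: compact_svd_def matrix_vector_mul_assoc)

lemma compact_svd_norm_mult:
  assumes "compact_svd J U \<Sigma> V"
  shows "norm (U *v z) = norm z" "norm (V *v z) = norm z"
  by (simp_all add: norm_eq_sqrt_inner matrix_vector_inner_transpose compact_svd_transpose_mult[OF assms])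

text \<open>Cauchy-Schwarz applied to \<open>U U\<^sup>T y\<close> and \<open>y\<close>, with
  \<open>U\<close> isometric. It bounds the length of a step by the norm of the residual.\<close>

lemma compact_svd_norm_transpose_mult:
  assumes "compact_svd J U \<Sigma> V"
  shows "norm (transpose U *v y) \<le> norm y"
proof -
  let ?c = "transpose U *v y"
  have "(norm ?c)\<^sup>2 = (U *v ?c) \<bullet> y"
    by (simp add: power2_norm_eq_inner matrix_vector_inner_transpose)
  also have "\<dots> \<le> norm (U *v ?c) * norm y"
    by (rule norm_cauchy_schwarz)
  finally have "norm ?c * norm ?c \<le> norm ?c * norm y"
    by (simp add: compact_svd_norm_mult[OF assms] power2_eq_square)
  then show ?thesis
    by (cases "?c = 0") auto
qed

lemma compact_svd_diagonal:
  assumes "compact_svd J U \<Sigma> V"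
  shows "(\<Sigma> *v z) $ i = \<Sigma> $ i $ i * z $ i"
    and "\<Sigma> $ i $ i \<in> nonzero_singular_values J"
proof -
  have "\<Sigma> $ i $ j * z $ j = (if j = i then \<Sigma> $ i $ i * z $ i else 0)" for j
    using assms by (auto simp: compact_svd_def)
  then have "(\<Sum>j\<in>UNIV. \<Sigma> $ i $ j * z $ j) = (\<Sum>j\<in>UNIV. if j = i then \<Sigma> $ i $ i * z $ i else 0)"
    by (rule sum.cong[OF refl])
  then show "(\<Sigma> *v z) $ i = \<Sigma> $ i $ i * z $ i"
    by (simp add: matrix_vector_mult_def)
  show "\<Sigma> $ i $ i \<in> nonzero_singular_values J"
    using assms by (auto simp: compact_svd_def)
qed

text \<open>\<open>U U\<^sup>T\<close> projects orthogonally onto the range of \<open>J\<close>.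
  This links the projection in the definition of an adapted neighborhood with the factors used by
  the iteration.\<close>

lemma orth_proj_orthogonal_comp_range:
  assumes svd: "compact_svd J U \<Sigma> V"
  shows "orth_proj ((range (\<lambda>h. J *v h))\<^sup>\<bottom>) y = y - U *v (transpose U *v y)"
proof -
  let ?R = "range (\<lambda>h. J *v h)"
  let ?p = "U *v (transpose U *v y)"
  \<comment> \<open>This is \<open>\<Sigma>\<^sup>-\<^sup>1 U\<^sup>T y\<close>, so that
    \<open>V ?z\<close> is a preimage of \<open>U U\<^sup>T y\<close> under
    \<open>J\<close>.\<close>
  let ?z = "\<chi> i. (transpose U *v y) $ i / \<Sigma> $ i $ i"
  have "\<Sigma> $ i $ i \<noteq> 0" for i
    using compact_svd_diagonal(2)[OF svd, of i] by (auto simp: nonzero_singular_values_def)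
  then have "\<Sigma> *v ?z = transpose U *v y"
    by (simp add: vec_eq_iff compact_svd_diagonal(1)[OF svd])
  then have "?p = J *v (V *v ?z)"
    by (simp add: compact_svd_mult_vector[OF svd] compact_svd_transpose_mult[OF svd])
  then have p: "?p \<in> ?R\<^sup>\<bottom>\<^sup>\<bottom>"
    by (auto simp: orthogonal_comp_def orthogonal_def inner_commute)
  have q: "y - ?p \<in> ?R\<^sup>\<bottom>"
    by (auto simp: orthogonal_comp_def orthogonal_def compact_svd_mult_vector[OF svd]
        matrix_vector_inner_transpose matrix_vector_mult_diff_distrib compact_svd_transpose_mult[OF svd])
  show ?thesis
    unfolding orth_proj_def
  proof (rule the_equality)
    fix w assume w: "w \<in> ?R\<^sup>\<bottom> \<and> y - w \<in> ?R\<^sup>\<bottom>\<^sup>\<bottom>"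
    \<comment> \<open>The difference of two candidates lies in a subspace and in its orthogonal
      complement, hence is orthogonal to itself.\<close>
    let ?d = "w - (y - ?p)"
    have "?d \<in> ?R\<^sup>\<bottom>"
      using w q by (meson subspace_diff subspace_orthogonal_comp)
    moreover have "?d = ?p - (y - w)" by simp
    then have "?d \<in> ?R\<^sup>\<bottom>\<^sup>\<bottom>"
      using w p by (metis subspace_diff subspace_orthogonal_comp)
    ultimately have "orthogonal ?d ?d"
      unfolding orthogonal_comp_def[of "?R\<^sup>\<bottom>"] by blast
    then have "?d = 0" unfolding orthogonal_self .
    then show "w = y - ?p" by simp
  qed (use p q in simp)
qed

section \<open>One step on the linearized residual\<close>

text \<open>Since \<open>J V U\<^sup>T = U \<Sigma> U\<^sup>T\<close>, each coordinate of
  \<open>y\<close> along a column of \<open>U\<close> is multiplied by some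
  \<open>1 - \<alpha> \<sigma>\<close>, which lies between 0 and \<open>1 - \<alpha> a\<close>
  because \<open>\<alpha> b \<le> 1\<close>. The part orthogonal to the range is left
  unchanged.\<close>

lemma svd_step_residual:
  assumes svd: "compact_svd J U \<Sigma> V" and sv: "nonzero_singular_values J \<subseteq> {a..b}"
    and "b > 0" "0 < \<alpha>" "\<alpha> \<le> 1 / b"
  shows "norm (y - \<alpha> *\<^sub>R (J *v ((V ** transpose U) *v y)))
    \<le> (1 - \<alpha> * a) * norm y + norm (orth_proj ((range (\<lambda>h. J *v h))\<^sup>\<bottom>) y)"
proof -
  let ?c = "transpose U *v y"
  let ?e = "?c - \<alpha> *\<^sub>R (\<Sigma> *v ?c)"
  have S: "\<alpha> * a \<le> \<alpha> * \<Sigma> $ i $ i" "\<alpha> * \<Sigma> $ i $ i \<le> 1" for i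
  proof -
    have s: "a \<le> \<Sigma> $ i $ i" "\<Sigma> $ i $ i \<le> b"
      using compact_svd_diagonal(2)[OF svd, of i] sv by auto
    then show "\<alpha> * a \<le> \<alpha> * \<Sigma> $ i $ i" using assms(4) by simp
    have "\<alpha> * \<Sigma> $ i $ i \<le> \<alpha> * b" using s assms(4) by simp
    also have "\<dots> \<le> 1" using assms by (simp add: field_simps)
    finally show "\<alpha> * \<Sigma> $ i $ i \<le> 1" .
  qed
  \<comment> \<open>Any index will do: the index type is nonempty, so some singular value lies
    between \<open>a\<close> and \<open>1 / \<alpha>\<close>.\<close>
  have nonneg: "0 \<le> 1 - \<alpha> * a"
    using S[of undefined] by linarith
  have "norm ?e \<le> norm ((1 - \<alpha> * a) *\<^sub>R ?c)"
  proof (rule norm_le_componentwise_cart)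
    fix i
    have "?e $ i = (1 - \<alpha> * \<Sigma> $ i $ i) * ?c $ i"
      by (simp add: compact_svd_diagonal(1)[OF svd] algebra_simps)
    then show "norm (?e $ i) \<le> norm (((1 - \<alpha> * a) *\<^sub>R ?c) $ i)"
      using S[of i] by (auto simp: abs_mult intro!: mult_right_mono)
  qed
  also have "\<dots> \<le> (1 - \<alpha> * a) * norm y"
    using nonneg compact_svd_norm_transpose_mult[OF svd] by (simp add: mult_left_mono)
  finally have e: "norm (U *v ?e) \<le> (1 - \<alpha> * a) * norm y"
    by (simp only: compact_svd_norm_mult[OF svd])
  have "y - \<alpha> *\<^sub>R (J *v ((V ** transpose U) *v y)) = U *v ?e + (y - U *v ?c)"
    by (simp add: compact_svd_mult_vector[OF svd] compact_svd_transpose_mult[OF svd]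
        matrix_vector_mult_diff_distrib matrix_vector_mult_scaleR flip: matrix_vector_mul_assoc)
  then show ?thesis
    using e norm_triangle_ineq[of "U *v ?e" "y - U *v ?c"]
    by (simp only: orth_proj_orthogonal_comp_range[OF svd])
qed

section \<open>Quadratic Taylor remainder on a ball\<close>

text \<open>The continuous second derivative is bounded on the compact ball, so the first derivative
  is Lipschitz there, and the mean value inequality along the segment gives the estimate. The factor
  1/2 of Taylor's formula is given away.\<close>

lemma C2_map_quadratic_remainder:
  fixes F :: "real^'m \<Rightarrow> real^'n"
  assumes "C2_map F"
  obtains K where "K > 0"
    "\<And>x y. x \<in> cball a d \<Longrightarrow> y \<in> cball a d \<Longrightarrow>
       norm (F y - F x - jacobian F (at x) *v (y - x)) \<le> K * (norm (y - x))\<^sup>2"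
proof -
  obtain F' :: "real^'m \<Rightarrow> (real^'m) \<Rightarrow>\<^sub>L (real^'n)"
    and F'' :: "real^'m \<Rightarrow> (real^'m) \<Rightarrow>\<^sub>L ((real^'m) \<Rightarrow>\<^sub>L (real^'n))"
    where F': "\<And>x. (F has_derivative blinfun_apply (F' x)) (at x)"
      and F'': "\<And>x. (F' has_derivative blinfun_apply (F'' x)) (at x)"
      and cont: "continuous_on UNIV F''"
    using assms unfolding C2_map_def by blast
  have "bounded (F'' ` cball a d)"
    using cont by (intro compact_imp_bounded compact_continuous_image)
      (auto intro: continuous_on_subset)
  then obtain K where K: "K > 0" "\<And>x. x \<in> cball a d \<Longrightarrow> norm (F'' x) \<le> K"
    unfolding bounded_pos by auto
  have Lip: "norm (F' x - F' y) \<le> K * norm (x - y)" if "x \<in> cball a d" "y \<in> cball a d" for x y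
    using differentiable_bound[OF convex_cball has_derivative_at_withinI[OF F''] _ that] K(2)
    by (simp add: norm_blinfun.rep_eq)
  have "norm (F y - F x - jacobian F (at x) *v (y - x)) \<le> K * (norm (y - x))\<^sup>2"
    if xy: "x \<in> cball a d" "y \<in> cball a d" for x y
  proof -
    have seg: "closed_segment x y \<subseteq> cball a d"
      using xy by (simp add: closed_segment_subset)
    have "norm (F y - F x - blinfun_apply (F' x) (y - x)) \<le> norm (y - x) * (K * norm (y - x))"
    proof (rule differentiable_bound_linearization[where S = "closed_segment x y"])
      show "x + t *\<^sub>R (y - x) \<in> closed_segment x y" if "t \<in> {0..1}" for t
        using that by (auto simp: in_segment algebra_simps intro!: exI[of _ t])
      show "(F has_derivative blinfun_apply (F' z)) (at z within closed_segment x y)" for z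
        by (rule has_derivative_at_withinI[OF F'])
      show "onorm (blinfun_apply (F' z) - blinfun_apply (F' x)) \<le> K * norm (y - x)"
        if z: "z \<in> closed_segment x y" for z
      proof -
        have "onorm (blinfun_apply (F' z) - blinfun_apply (F' x)) = norm (F' z - F' x)"
          by (simp add: norm_blinfun.rep_eq minus_blinfun.rep_eq fun_diff_def)
        also have "\<dots> \<le> K * norm (z - x)" using Lip z seg xy by blast
        also have "\<dots> \<le> K * norm (y - x)"
          using K(1) segment_bound(1)[OF z] by simp
        finally show ?thesis .
      qed
    qed simp
    \<comment> \<open>Uniqueness of the derivative identifies the Jacobian matrix with the bounded
      linear map \<open>F' x\<close>.\<close>
    moreover have "jacobian F (at x) *v (y - x) = blinfun_apply (F' x) (y - x)"
      using F'[of x] by (metis has_derivative_unique jacobian_works differentiableI)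
    ultimately show ?thesis by (simp add: power2_eq_square mult_ac)
  qed
  with K(1) that show ?thesis by blast
qed

section \<open>Invariant neighborhood and linear decay\<close>

theorem theorem2:
  fixes F :: "real^'m \<Rightarrow> real^'n"
    and f :: "real^'m \<Rightarrow> real"
    and \<theta>s :: "real^'m"
    and U W :: "(real^'m) set"
    and \<pi> :: "real^'m \<Rightarrow> real^'m"
    and L \<sigma>min \<sigma>max :: real
  assumes "C2_map F"
    and "\<And>\<theta>. f \<theta> = 1/2 * (norm (F \<theta>))\<^sup>2"
    and "F \<theta>s = 0"
    and "open U" and "\<theta>s \<in> U"
    and "\<And>\<theta>. \<theta> \<in> U \<Longrightarrow> rank (jacobian F (at \<theta>)) = CARD('r::finite)"
    and "L > 0"
    and "\<And>\<theta>1 \<theta>2. \<theta>1 \<in> U \<Longrightarrow> \<theta>2 \<in> U \<Longrightarrow>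
           norm (grad f \<theta>1 - grad f \<theta>2) \<le> L * norm (\<theta>1 - \<theta>2)"
    and "adapted_neighborhood F U \<theta>s W \<pi>"
    and "\<sigma>min > 0" and "\<sigma>max > 0"
    and "\<And>\<theta>. \<theta> \<in> W \<Longrightarrow> nonzero_singular_values (jacobian F (at \<theta>)) \<subseteq> {\<sigma>min..\<sigma>max}"
  shows "\<forall>\<alpha>. 0 < \<alpha> \<and> \<alpha> \<le> 1 / \<sigma>max \<longrightarrow>
    (\<exists>U\<alpha>. open U\<alpha> \<and> \<theta>s \<in> U\<alpha> \<and> U\<alpha> \<subseteq> W \<and>
      (\<forall>\<theta>0\<in>U\<alpha>.
        (\<exists>\<theta> (Ut :: nat \<Rightarrow> real^'r^'n) \<Sigma>t Vt. svd_iteration F \<alpha> \<theta> Ut \<Sigma>t Vt \<and> \<theta> 0 = \<theta>0) \<and>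
        (\<forall>\<theta> (Ut :: nat \<Rightarrow> real^'r^'n) \<Sigma>t Vt. svd_iteration F \<alpha> \<theta> Ut \<Sigma>t Vt \<and> \<theta> 0 = \<theta>0 \<longrightarrow>
          (\<forall>t. f (\<theta> t) \<le> (1 - \<alpha> * \<sigma>min / 2) ^ t * f \<theta>0) \<and>
          converges_linearly (\<lambda>t. f (\<theta> t)) 0)))"
proof (intro allI impI)
  fix \<alpha> assume \<alpha>: "0 < \<alpha> \<and> \<alpha> \<le> 1 / \<sigma>max"
  have W: "open W" "\<theta>s \<in> W" "W \<subseteq> U"
    using assms(9) unfolding adapted_neighborhood_def tubular_neighborhood_def by blast+
  obtain C where C: "C > 0"
    "\<And>\<theta>. \<theta> \<in> W \<Longrightarrow> norm (orth_proj ((jac_range F \<theta>)\<^sup>\<bottom>) (F \<theta>)) \<le> C * (norm (F \<theta>))\<^sup>2"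
    using assms(9) unfolding adapted_neighborhood_def by blast
  obtain \<delta> where \<delta>: "\<delta> > 0" "cball \<theta>s \<delta> \<subseteq> W"
    using W open_contains_cball by blast
  obtain K where K: "K > 0" "\<And>x y. x \<in> cball \<theta>s \<delta> \<Longrightarrow> y \<in> cball \<theta>s \<delta> \<Longrightarrow>
      norm (F y - F x - jacobian F (at x) *v (y - x)) \<le> K * (norm (y - x))\<^sup>2"
    using C2_map_quadratic_remainder[OF assms(1)] by blast
  have ex_svd: "\<exists>(Ut :: real^'r^'n) \<Sigma>t Vt. compact_svd (jacobian F (at \<theta>)) Ut \<Sigma>t Vt" if "\<theta> \<in> W" for \<theta>
    using that W(3) assms(6) by (intro ex_compact_svd) blast
  \<comment> \<open>The linearized step gains the factor \<open>1 - x\<close>. Half of this gain is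
    kept in \<open>q\<close>; the other half pays for the quadratic terms collected in
    \<open>M\<close>, where \<open>C\<close> comes from the part of \<open>F\<close> orthogonal to
    the range and \<open>K \<alpha>\<^sup>2\<close> from the Taylor remainder of a step of length at
    most \<open>\<alpha> |F|\<close>.\<close>
  define x where "x = \<alpha> * \<sigma>min"
  define q where "q = 1 - x / 2"
  define M where "M = C + K * \<alpha>\<^sup>2"
  \<comment> \<open>A singular value at \<open>\<theta>s\<close> exists because the rank is
    positive, and it forces \<open>\<sigma>min \<le> \<sigma>max\<close>.\<close>
  have x: "0 < x" "x \<le> 1"
  proof -
    obtain Ut :: "real^'r^'n" and \<Sigma>t Vt where "compact_svd (jacobian F (at \<theta>s)) Ut \<Sigma>t Vt"
      using ex_svd[OF W(2)] by blast
    from compact_svd_diagonal(2)[OF this] have "\<sigma>min \<le> \<sigma>max"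
      using assms(12)[OF W(2)] by fastforce
    then have "x \<le> \<alpha> * \<sigma>max" using \<alpha> by (simp add: x_def)
    also have "\<dots> \<le> 1" using \<alpha> assms(11) by (simp add: field_simps)
    finally show "x \<le> 1" .
    show "0 < x" using \<alpha> assms(10) by (simp add: x_def)
  qed
  have q: "0 < q" "q < 1" using x by (simp_all add: q_def)
  \<comment> \<open>One step moves the iterate by at most \<open>\<alpha> |F|\<close> and contracts \<open>|F|\<close> by \<open>q\<close>; since
    \<open>\<alpha> + (2 \<alpha> / x) q = 2 \<alpha> / x\<close>, the weight \<open>2 \<alpha> / x\<close> makes \<open>G\<close> invariant.\<close>
  define G where "G = {\<theta>. dist \<theta>s \<theta> + 2 * \<alpha> / x * norm (F \<theta>) < \<delta> \<and> M * norm (F \<theta>) < x / 2}"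
  have contF: "continuous_on UNIV F"
    using assms(1) unfolding C2_map_def
    by (meson continuous_at_imp_continuous_on has_derivative_continuous)
  have openG: "open G"
    unfolding G_def by (intro open_Collect_conj open_Collect_less continuous_intros contF)
  have \<theta>sG: "\<theta>s \<in> G" using \<delta>(1) x(1) assms(3) by (simp add: G_def)
  have Gball: "G \<subseteq> cball \<theta>s \<delta>"
  proof
    fix \<theta> assume "\<theta> \<in> G"
    moreover have "0 \<le> 2 * \<alpha> / x * norm (F \<theta>)" using \<alpha> x by simp
    ultimately show "\<theta> \<in> cball \<theta>s \<delta>" by (simp add: G_def)
  qed
  have step: "\<theta>' \<in> G \<and> norm (F \<theta>') \<le> q * norm (F \<theta>)"
    if \<theta>: "\<theta> \<in> G" and svd: "compact_svd (jacobian F (at \<theta>)) Ut \<Sigma>t Vt"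
      and \<theta>': "\<theta>' = \<theta> - \<alpha> *\<^sub>R ((Vt ** transpose Ut) *v F \<theta>)"
    for \<theta> \<theta>' and Ut :: "real^'r^'n" and \<Sigma>t Vt
  proof -
    let ?J = "jacobian F (at \<theta>)"
    have ball: "\<theta> \<in> cball \<theta>s \<delta>" using \<theta> Gball by blast
    then have "\<theta> \<in> W" using \<delta>(2) by blast
    have "norm ((Vt ** transpose Ut) *v F \<theta>) \<le> norm (F \<theta>)"
      using compact_svd_norm_mult(2)[OF svd] compact_svd_norm_transpose_mult[OF svd]
      by (simp flip: matrix_vector_mul_assoc)
    then have diff: "norm (\<theta>' - \<theta>) \<le> \<alpha> * norm (F \<theta>)"
      using \<alpha> by (simp add: \<theta>')
    then have dist: "dist \<theta>s \<theta>' \<le> dist \<theta>s \<theta> + \<alpha> * norm (F \<theta>)"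
      using dist_triangle[of \<theta>s \<theta>' \<theta>] by (simp add: dist_norm norm_minus_commute)
    \<comment> \<open>The weight in \<open>G\<close> exceeds \<alpha>, so the first condition of
      \<open>G\<close> leaves room for a whole step. The new point is thus in the ball before its
      residual is known, as the Taylor estimate requires.\<close>
    have "\<alpha> \<le> 2 * \<alpha> / x" using \<alpha> x by (simp add: field_simps)
    then have "\<alpha> * norm (F \<theta>) \<le> 2 * \<alpha> / x * norm (F \<theta>)" by (rule mult_right_mono) simp
    then have ball': "\<theta>' \<in> cball \<theta>s \<delta>"
      using dist \<theta> by (simp add: G_def)
    have "(norm (\<theta>' - \<theta>))\<^sup>2 \<le> (\<alpha> * norm (F \<theta>))\<^sup>2"
      using diff by (intro power_mono) auto
    then have "norm (F \<theta>' - F \<theta> - ?J *v (\<theta>' - \<theta>)) \<le> K * \<alpha>\<^sup>2 * (norm (F \<theta>))\<^sup>2"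
      using K(2)[OF ball ball'] K(1)
      by (smt (verit, ccfv_SIG) mult.assoc mult_left_mono power_mult_distrib)
    moreover have "norm (F \<theta> + ?J *v (\<theta>' - \<theta>)) \<le> (1 - x) * norm (F \<theta>) + C * (norm (F \<theta>))\<^sup>2"
      using svd_step_residual[OF svd assms(12)[OF \<open>\<theta> \<in> W\<close>] assms(11), of \<alpha> "F \<theta>"] \<alpha>
        C(2)[OF \<open>\<theta> \<in> W\<close>] unfolding jac_range_def
      by (simp add: \<theta>' x_def matrix_vector_mult_scaleR linear_neg[OF matrix_vector_mul_linear])
    ultimately have "norm (F \<theta>') \<le> (1 - x) * norm (F \<theta>) + M * (norm (F \<theta>))\<^sup>2"
      using norm_triangle_ineq[of "F \<theta> + ?J *v (\<theta>' - \<theta>)" "F \<theta>' - F \<theta> - ?J *v (\<theta>' - \<theta>)"]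
      by (simp add: M_def algebra_simps)
    \<comment> \<open>The second condition of \<open>G\<close> turns the quadratic term into a
      linear one that costs only half of the gain.\<close>
    also have "M * (norm (F \<theta>))\<^sup>2 \<le> x / 2 * norm (F \<theta>)"
      unfolding power2_eq_square mult.assoc[symmetric] using \<theta>
      by (intro mult_right_mono) (auto simp: G_def)
    finally have contr: "norm (F \<theta>') \<le> q * norm (F \<theta>)"
      by (simp add: q_def algebra_simps)
    also have "\<dots> \<le> norm (F \<theta>)" using q by (simp add: mult_left_le_one_le)
    finally have "M * norm (F \<theta>') \<le> M * norm (F \<theta>)"
      using C(1) K(1) by (intro mult_left_mono) (auto simp: M_def)
    moreover have "2 * \<alpha> / x * norm (F \<theta>') \<le> 2 * \<alpha> / x * (q * norm (F \<theta>))"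
      using contr \<alpha> x by (intro mult_left_mono) auto
    moreover have "\<alpha> * norm (F \<theta>) + 2 * \<alpha> / x * (q * norm (F \<theta>)) = 2 * \<alpha> / x * norm (F \<theta>)"
      using x by (simp add: q_def field_simps)
    ultimately have "\<theta>' \<in> G" using \<theta> dist unfolding G_def by simp
    with contr show ?thesis by blast
  qed
  have ex_iteration: "\<exists>\<theta> (Ut :: nat \<Rightarrow> real^'r^'n) \<Sigma>t Vt. svd_iteration F \<alpha> \<theta> Ut \<Sigma>t Vt \<and> \<theta> 0 = \<theta>0"
    if "\<theta>0 \<in> G" for \<theta>0
  proof -
    \<comment> \<open>One decomposition is chosen for each point of \<open>W\<close>. The iteration
      built from these choices never leaves \<open>G\<close>, hence stays where they are
      valid.\<close>
    obtain u :: "real^'m \<Rightarrow> real^'r^'n" and s v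
      where usv: "\<And>\<theta>. \<theta> \<in> W \<Longrightarrow> compact_svd (jacobian F (at \<theta>)) (u \<theta>) (s \<theta>) (v \<theta>)"
      using ex_svd by metis
    define \<theta> where "\<theta> t = ((\<lambda>p. p - \<alpha> *\<^sub>R ((v p ** transpose (u p)) *v F p)) ^^ t) \<theta>0" for t
    have "\<theta> t \<in> G" for t
    proof (induction t)
      case (Suc t)
      then have "\<theta> t \<in> W" using Gball \<delta>(2) by blast
      from step[OF Suc usv[OF this]] show ?case by (simp add: \<theta>_def)
    qed (simp add: \<theta>_def that)
    then have "svd_iteration F \<alpha> \<theta> (\<lambda>t. u (\<theta> t)) (\<lambda>t. s (\<theta> t)) (\<lambda>t. v (\<theta> t))"
      unfolding svd_iteration_def using usv Gball \<delta>(2) by (auto simp: \<theta>_def)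
    then show ?thesis by (force simp: \<theta>_def)
  qed
  have decay: "(\<forall>t. f (\<theta> t) \<le> (1 - \<alpha> * \<sigma>min / 2) ^ t * f \<theta>0) \<and>
      converges_linearly (\<lambda>t. f (\<theta> t)) 0"
    if "\<theta>0 \<in> G" and it: "svd_iteration F \<alpha> \<theta> Ut \<Sigma>t Vt" and "\<theta> 0 = \<theta>0"
    for \<theta>0 \<theta> and Ut :: "nat \<Rightarrow> real^'r^'n" and \<Sigma>t Vt
  proof -
    have next_step: "\<theta> (Suc t) \<in> G \<and> norm (F (\<theta> (Suc t))) \<le> q * norm (F (\<theta> t))"
      if "\<theta> t \<in> G" for t
      using step[OF that] it unfolding svd_iteration_def by blast
    have G: "\<theta> t \<in> G" for t
      by (induction t) (use next_step that in auto)
    have bound: "f (\<theta> t) \<le> q ^ t * f \<theta>0" for t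
    proof (induction t)
      case (Suc t)
      \<comment> \<open>The norm of \<open>F\<close> contracts by \<open>q\<close>, so
        \<open>f\<close> contracts even by \<open>q\<^sup>2\<close>; as \<open>q < 1\<close>, the
        weaker factor \<open>q\<close> of the claim suffices.\<close>
      have "(norm (F (\<theta> (Suc t))))\<^sup>2 \<le> (q * norm (F (\<theta> t)))\<^sup>2"
        using next_step[OF G] by (intro power_mono) auto
      also have "\<dots> = q * (q * (norm (F (\<theta> t)))\<^sup>2)"
        by (simp add: power2_eq_square)
      also have "\<dots> \<le> q * (norm (F (\<theta> t)))\<^sup>2"
        using q by (simp add: mult_left_le_one_le)
      finally have "f (\<theta> (Suc t)) \<le> q * f (\<theta> t)"
        by (simp add: assms(2))
      also have "\<dots> \<le> q * (q ^ t * f \<theta>0)"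
        using Suc q by simp
      finally show ?case by (simp add: mult.assoc)
    qed (simp add: \<open>\<theta> 0 = \<theta>0\<close>)
    then have "dist (f (\<theta> t)) 0 \<le> f \<theta>0 * q ^ t" for t
      by (simp add: assms(2) mult.commute)
    then have "converges_linearly (\<lambda>t. f (\<theta> t)) 0"
      unfolding converges_linearly_def using q by blast
    with bound show ?thesis by (simp add: q_def x_def)
  qed
  show "\<exists>U\<alpha>. open U\<alpha> \<and> \<theta>s \<in> U\<alpha> \<and> U\<alpha> \<subseteq> W \<and>
      (\<forall>\<theta>0\<in>U\<alpha>.
        (\<exists>\<theta> (Ut :: nat \<Rightarrow> real^'r^'n) \<Sigma>t Vt. svd_iteration F \<alpha> \<theta> Ut \<Sigma>t Vt \<and> \<theta> 0 = \<theta>0) \<and>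
        (\<forall>\<theta> (Ut :: nat \<Rightarrow> real^'r^'n) \<Sigma>t Vt. svd_iteration F \<alpha> \<theta> Ut \<Sigma>t Vt \<and> \<theta> 0 = \<theta>0 \<longrightarrow>
          (\<forall>t. f (\<theta> t) \<le> (1 - \<alpha> * \<sigma>min / 2) ^ t * f \<theta>0) \<and>
          converges_linearly (\<lambda>t. f (\<theta> t)) 0))"
    using openG \<theta>sG Gball \<delta>(2) ex_iteration decay
    by (intro exI[of _ G] conjI ballI allI impI) auto
qed

end
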